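(* Let $m,n\geq 1$ be integers. The metasylvester poset, i.e. the set $\mathcal{M}ax_n^{(m)}$ of maximal elements of the metasylvester classes of $m$-permutations of size $n$, with the partial order induced by the $m$-permutations lattice $\mathfrak{S}_n^{(m)}$, is a lattice.
   Context: An $m$-permutation of size $n$ is a rearrangement of the word $1^m2^m\cdots n^m$; their set is $\mathfrak{S}_n^{(m)}$. For a letter $a$, $a_i$ denotes the $i$-th occurrence of $a$ from the left. A co-inversion of $\sigma\in\mathfrak{S}_n^{(m)}$ is a pair $(a_i,b_j)$ with $1\leq a<b\leq n$, $1\le i,j\le m$, such that $b_j$ appears before (to the left of) $a_i$ in $\sigma$; $\mathrm{coinv}(\sigma)$ is the set of co-inversions. The order on $\mathfrak{S}_n^{(m)}$ is: $\sigma\leq\mu$ if and only if $\mathrm{coinv}(\sigma)\subseteq\mathrm{coinv}(\mu)$. It is a lattice, called the $m$-permutations lattice (via standardization it is a lower ideal of the right weak order on the symmetric group $\mathfrak{S}_{mn}$). The metasylvester congruence $\equiv$ on $\mathfrak{S}_n^{(m)}$ is the equivalence relation generated by $u\,ac\,v\,a\,w\equiv u\,ca\,v\,a\,w$ for letters $a<c$ and words $u,v,w$, and $u\,b\,v\,ac\,w\,b\,x\equiv u\,b\,v\,ca\,w\,b\,x$ for letters $a<b<c$ and words $u,v,w,x$. Its classes are the metasylvester classes. Each metasylvester class has a unique maximal element for the order of $\mathfrak{S}_n^{(m)}$; it is the only element of the class containing no subword (not necessarily consecutive) $a\cdots b\cdots a$ with $a<b$. $\mathcal{M}ax_n^{(m)}$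 is the set of these maximal elements. *)

theory Defs
  imports "HOL-Algebra.Lattice" "HOL-Library.Multiset"
begin

definition mperms :: "nat \<Rightarrow> nat \<Rightarrow> nat list set" where
  "mperms m n = {\<sigma>. mset \<sigma> = mset (concat (map (replicate m) [1..<Suc n]))}"

text \<open>The letter \<open>a\<^sub>i\<close> (the \<open>i\<close>-th occurrence of \<open>a\<close> from the left, counted from 1)
  stands at the (0-based) position \<open>p\<close> of \<open>\<sigma>\<close>.\<close>

definition occ_at :: "nat list \<Rightarrow> nat \<Rightarrow> nat \<Rightarrow> nat \<Rightarrow> bool" where
  "occ_at \<sigma> a i p \<longleftrightarrow> p < length \<sigma> \<and> \<sigma> ! p = a \<and> count_list (take (Suc p) \<sigma>) a = i"

text \<open>The pair \<open>(a\<^sub>i, b\<^sub>j)\<close> is encoded as \<open>((a, i), (b, j))\<close>. The range restrictions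
  \<open>1 \<le> a\<close>, \<open>b \<le> n\<close> and \<open>1 \<le> i, j \<le> m\<close> hold automatically, see \<open>coinv_bounds\<close>.\<close>

definition coinv :: "nat list \<Rightarrow> ((nat \<times> nat) \<times> (nat \<times> nat)) set" where
  "coinv \<sigma> = {((a, i), (b, j)) | a i b j.
     a < b \<and> (\<exists>p q. p < q \<and> occ_at \<sigma> b j p \<and> occ_at \<sigma> a i q)}"

definition mperm_lattice :: "nat \<Rightarrow> nat \<Rightarrow> nat list gorder" where
  "mperm_lattice m n =
     \<lparr>carrier = mperms m n, eq = (=), le = (\<lambda>\<sigma> \<mu>. coinv \<sigma> \<subseteq> coinv \<mu>)\<rparr>"

inductive metasylvester_step :: "nat list \<Rightarrow> nat list \<Rightarrow> bool" where
  "a < c \<Longrightarrow>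
     metasylvester_step (u @ [a, c] @ v @ [a] @ w) (u @ [c, a] @ v @ [a] @ w)"
| "a < b \<Longrightarrow> b < c \<Longrightarrow>
     metasylvester_step (u @ [b] @ v @ [a, c] @ w @ [b] @ x) (u @ [b] @ v @ [c, a] @ w @ [b] @ x)"

text \<open>Rewriting steps only permute letters, so they never leave the set of \<open>m\<close>-permutations;
  hence generating the equivalence on all words and restricting it is the same as
  generating it on the \<open>m\<close>-permutations, see \<open>metasylvester_mset\<close>.\<close>

definition metasylvester_cong :: "nat \<Rightarrow> nat \<Rightarrow> (nat list \<times> nat list) set" where
  "metasylvester_cong m n =
     {(\<sigma>, \<mu>). \<sigma> \<in> mperms m n \<and> \<mu> \<in> mperms m n \<and> equivclp metasylvester_step \<sigma> \<mu>}"

definition metasylvester_classes :: "nat \<Rightarrow> nat \<Rightarrow> nat list set set" where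
  "metasylvester_classes m n = mperms m n // metasylvester_cong m n"

definition metasylvester_max :: "nat \<Rightarrow> nat \<Rightarrow> nat list set" where
  "metasylvester_max m n =
     {\<sigma>. \<exists>C \<in> metasylvester_classes m n. \<sigma> \<in> C \<and>
           (\<forall>\<mu> \<in> C. \<sigma> \<sqsubseteq>\<^bsub>mperm_lattice m n\<^esub> \<mu> \<longrightarrow> \<mu> = \<sigma>)}"

definition metasylvester_poset :: "nat \<Rightarrow> nat \<Rightarrow> nat list gorder" where
  "metasylvester_poset m n = (mperm_lattice m n)\<lparr>carrier := metasylvester_max m n\<rparr>"

lemma coinv_bounds:
  assumes "\<sigma> \<in> mperms m n" "((a, i), (b, j)) \<in> coinv \<sigma>"
  shows "1 \<le> a \<and> a < b \<and> b \<le> n \<and> 1 \<le> i \<and> i \<le> m \<and> 1 \<le> j \<and> j \<le> m"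
proof -
  have ms: "mset \<sigma> = mset (concat (map (replicate m) [1..<Suc n]))"
    using assms(1) by (simp add: mperms_def)
  have occ: "1 \<le> x \<and> x \<le> n \<and> 1 \<le> k \<and> k \<le> m" if "occ_at \<sigma> x k p" for x k p
  proof -
    have p: "p < length \<sigma>" "\<sigma> ! p = x" and k: "count_list (take (Suc p) \<sigma>) x = k"
      using that by (auto simp: occ_at_def)
    have "x \<in> set \<sigma>"
      using p by auto
    then have x: "1 \<le> x" "x \<le> n"
      using mset_eq_setD[OF ms] by auto
    have "count_list \<sigma> x = count (mset (concat (map (replicate m) [1..<Suc n]))) x"
      using ms by (metis count_mset)
    also have "\<dots> = (if 1 \<le> x \<and> x \<le> n then m else 0)"
      by (induction n) (auto simp: count_list_0_iff)
    finally have cnt: "count_list \<sigma> x = m"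
      using x by simp
    have "count_list \<sigma> x = count_list (take (Suc p) \<sigma>) x + count_list (drop (Suc p) \<sigma>) x"
      by (metis append_take_drop_id count_list_append)
    then have "k \<le> m"
      using cnt k by simp
    moreover have "1 \<le> k"
      using p k by (simp add: take_Suc_conv_app_nth)
    ultimately show ?thesis
      using x by simp
  qed
  obtain p q where "a < b" "occ_at \<sigma> b j p" "occ_at \<sigma> a i q"
    using assms(2) by (auto simp: coinv_def)
  then show ?thesis
    using occ by blast
qed

lemma metasylvester_mset:
  "equivclp metasylvester_step \<sigma> \<mu> \<Longrightarrow> mset \<sigma> = mset \<mu>"
proof (induction rule: equivclp_induct)
  case (step y z)
  have "metasylvester_step s t \<Longrightarrow> mset s = mset t" for s t
    by (induction rule: metasylvester_step.induct) auto
  then show ?case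
    using step by metis
qed simp

end

theory Submission
  imports Defs
begin

text \<open>A word is maximal in its metasylvester class iff it avoids the subwords \<open>a \<cdots> b \<cdots> a\<close> with
  \<open>a < b\<close>. If such a subword is present, a rewriting step adds a co-inversion. Conversely, both
  ends of a rewriting step lie below the same avoiding words, so an avoiding word is above its
  whole class; no confluence argument is needed.

  The avoiding words are closed under arbitrary meets of the weak order: along a chain
  \<open>a\<^sub>i \<rightarrow> \<cdots> \<rightarrow> b\<^sub>j\<close> of non-co-inversions, the arrow that leaves the letter \<open>a\<close> can start at every
  occurrence of \<open>a\<close>, since it comes from an avoiding word. Hence all meets exist, and joins are
  meets of the sets of upper bounds.\<close>

section \<open>Precedence in a list\<close>

text \<open>Only some occurrence of \<open>x\<close> before some occurrence of \<open>y\<close> is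
  asked for. On a distinct list this is the strict linear order of its entries, and it is applied to
  lists of labels, which are distinct.\<close>

fun precedes :: "'a list \<Rightarrow> 'a \<Rightarrow> 'a \<Rightarrow> bool" where
  "precedes [] x y \<longleftrightarrow> False"
| "precedes (z # zs) x y \<longleftrightarrow> x = z \<and> y \<in> set zs \<or> precedes zs x y"

lemma precedes_in_set:
  assumes "precedes xs x y"
  shows "x \<in> set xs" "y \<in> set xs"
  using assms by (induction xs) auto

lemma precedes_append:
  "precedes (xs @ ys) x y \<longleftrightarrow>
     precedes xs x y \<or> x \<in> set xs \<and> y \<in> set ys \<or> precedes ys x y"
  by (induction xs) auto

lemma precedes_iff_nth:
  "precedes xs x y \<longleftrightarrow> (\<exists>p q. p < q \<and> q < length xs \<and> xs ! p = x \<and> xs ! q = y)"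
proof
  show "\<exists>p q. p < q \<and> q < length xs \<and> xs ! p = x \<and> xs ! q = y" if "precedes xs x y"
    using that
  proof (induction xs)
    case (Cons z zs)
    consider q where "x = z" "q < length zs" "zs ! q = y"
      | p q where "p < q" "q < length zs" "zs ! p = x" "zs ! q = y"
      using Cons by (auto simp: in_set_conv_nth)
    then show ?case
    proof cases
      case (1 q)
      then show ?thesis
        by (intro exI[of _ 0] exI[of _ "Suc q"]) auto
    next
      case (2 p q)
      then show ?thesis
        by (intro exI[of _ "Suc p"] exI[of _ "Suc q"]) auto
    qed
  qed simp
  have "precedes xs (xs ! p) (xs ! q)" if "p < q" "q < length xs" for p q
    using that
  proof (induction xs arbitrary: p q)
    case (Cons z zs)
    then show ?case
      by (cases p; cases q) auto
  qed simp
  then show "precedes xs x y" if "\<exists>p q. p < q \<and> q < length xs \<and> xs ! p = x \<and> xs ! q = y"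
    using that by blast
qed

lemma precedes_asym: "distinct xs \<Longrightarrow> precedes xs x y \<Longrightarrow> \<not> precedes xs y x"
  by (induction xs) (auto dest: precedes_in_set)

lemma precedes_trans: "distinct xs \<Longrightarrow> precedes xs x y \<Longrightarrow> precedes xs y z \<Longrightarrow> precedes xs x z"
  by (induction xs) (auto dest: precedes_in_set)

lemma precedes_total:
  "x \<in> set xs \<Longrightarrow> y \<in> set xs \<Longrightarrow> x \<noteq> y \<Longrightarrow> precedes xs x y \<or> precedes xs y x"
  by (induction xs) auto

lemma sorted_wrt_iff_precedes: "sorted_wrt P xs \<longleftrightarrow> (\<forall>x y. precedes xs x y \<longrightarrow> P x y)"
  by (induction xs) auto

text \<open>A strict linear order contained in another one on the same set equals it. If the heads
  differed, the head of \<open>ys\<close> would come first in \<open>ys\<close> but after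
  \<open>x\<close> in \<open>xs\<close>, against asymmetry.\<close>

lemma precedes_determines_list:
  assumes "distinct xs" "distinct ys" "set xs = set ys"
    and "\<And>x y. precedes xs x y \<Longrightarrow> precedes ys x y"
  shows "xs = ys"
  using assms
proof (induction xs arbitrary: ys)
  case (Cons x xs)
  obtain y ys' where ys: "ys = y # ys'"
    using Cons.prems(3) by (cases ys) auto
  have "x = y"
  proof (rule ccontr)
    assume "x \<noteq> y"
    then have "precedes (x # xs) x y" "precedes ys y x"
      using Cons.prems(3) ys by auto
    then show False
      using Cons.prems(2,4) precedes_asym by metis
  qed
  moreover have "xs = ys'"
  proof (rule Cons.IH)
    show "distinct xs" "distinct ys'" "set xs = set ys'"
      using Cons.prems(1-3) ys \<open>x = y\<close> by auto
    show "precedes ys' u v" if "precedes xs u v" for u v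
      using that Cons.prems(1) Cons.prems(4)[of u v] ys \<open>x = y\<close> precedes_in_set(1)[OF that] by auto
  qed
  ultimately show ?case
    using ys by simp
qed simp

text \<open>Insertion of one element between those below and those above it. The order is an
  arbitrary relation, linear on \<open>A\<close> only, because it is later applied to an order built
  by hand on labels.\<close>

lemma sorted_list_exists:
  assumes "finite A"
    and "\<And>x y. x \<in> A \<Longrightarrow> y \<in> A \<Longrightarrow> x \<noteq> y \<Longrightarrow> R x y \<or> R y x"
    and "\<And>x y z. x \<in> A \<Longrightarrow> y \<in> A \<Longrightarrow> z \<in> A \<Longrightarrow> R x y \<Longrightarrow> R y z \<Longrightarrow> R x z"
    and "\<And>x. x \<in> A \<Longrightarrow> \<not> R x x"
  shows "\<exists>xs. distinct xs \<and> set xs = A \<and> sorted_wrt R xs"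
  using assms
proof (induction A rule: finite_induct)
  case empty
  show ?case
    by (rule exI[of _ "[]"]) simp
next
  case (insert x A)
  have "\<exists>xs. distinct xs \<and> set xs = A \<and> sorted_wrt R xs"
    by (rule insert.IH) (use insert.prems in \<open>blast+\<close>)
  then obtain xs where xs: "distinct xs" "set xs = A" "sorted_wrt R xs"
    by blast
  let ?l = "filter (\<lambda>y. R y x) xs" and ?r = "filter (\<lambda>y. R x y) xs"
  have tr: "R u w" if "u \<in> insert x A" "v \<in> insert x A" "w \<in> insert x A" "R u v" "R v w" for u v w
    using insert.prems(2) that by blast
  have irr: "\<not> R u u" if "u \<in> insert x A" for u
    using insert.prems(3) that by blast
  have tot: "R u x \<or> R x u" if "u \<in> A" for u
    using insert.prems(1) insert.hyps(2) that by blast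
  have "R u v" if "u \<in> A" "v \<in> A" "R u x" "R x v" for u v
    using tr that by blast
  then have "sorted_wrt R (?l @ [x] @ ?r)"
    using xs by (auto simp: sorted_wrt_append sorted_wrt_filter)
  moreover have "set (?l @ [x] @ ?r) = insert x A"
    using xs tot by auto
  moreover have "distinct (?l @ [x] @ ?r)"
    using xs(1,2) insert.hyps(2) tr irr by auto
  ultimately show ?case
    by blast
qed

section \<open>Words with labelled occurrences\<close>

text \<open>The letter \<open>a\<^sub>i\<close> is encoded as \<open>(a, i)\<close>; the multiset \<open>M\<close> records the letters already read.\<close>

fun labels_from :: "'a multiset \<Rightarrow> 'a list \<Rightarrow> ('a \<times> nat) list" where
  "labels_from M [] = []"
| "labels_from M (x # xs) = (x, Suc (count M x)) # labels_from (add_mset x M) xs"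

abbreviation labels :: "'a list \<Rightarrow> ('a \<times> nat) list" where
  "labels \<equiv> labels_from {#}"

text \<open>All rearrangements of \<open>W\<close> share these labels, so such words differ only by
  the linear order they put on one fixed set.\<close>

definition label_set :: "'a multiset \<Rightarrow> ('a \<times> nat) set" where
  "label_set W = {(a, i). 0 < i \<and> i \<le> count W a}"

lemma labels_from_append: "labels_from M (xs @ ys) = labels_from M xs @ labels_from (M + mset xs) ys"
  by (induction xs arbitrary: M) auto

lemma map_fst_labels_from [simp]: "map fst (labels_from M xs) = xs"
  by (induction xs arbitrary: M) auto

lemma length_labels_from [simp]: "length (labels_from M xs) = length xs"
  by (induction xs arbitrary: M) auto

lemma labels_from_nth:
  "p < length xs \<Longrightarrow>
     labels_from M xs ! p = (xs ! p, count M (xs ! p) + count_list (take (Suc p) xs) (xs ! p))"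
  by (induction xs arbitrary: M p) (auto simp: nth_Cons split: nat.split)

lemma set_labels_from:
  "set (labels_from M xs) = {(a, i). count M a < i \<and> i \<le> count M a + count (mset xs) a}"
  by (induction xs arbitrary: M) (auto split: if_splits)

lemma set_labels: "set (labels xs) = label_set (mset xs)"
  by (simp add: set_labels_from label_set_def)

lemma distinct_labels_from: "distinct (labels_from M xs)"
  by (induction xs arbitrary: M) (auto simp: set_labels_from)

lemma precedes_labels_from_same: "precedes (labels_from M xs) (a, i) (a, j) \<Longrightarrow> i < j"
  by (induction xs arbitrary: M) (auto simp: set_labels_from split: if_splits)

text \<open>Since equal letters carry increasing indices, the first entry must have the least index
  of its letter not read yet, which is the label that relabelling assigns. The bound
  \<open>f\<close> stays fixed while \<open>M\<close> grows along the induction.\<close>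

lemma labels_from_map_fst:
  assumes "distinct xs" "set xs = {(a, i). count M a < i \<and> i \<le> f a}"
    and "\<And>a i j. precedes xs (a, i) (a, j) \<Longrightarrow> i < j"
  shows "labels_from M (map fst xs) = xs"
  using assms
proof (induction xs arbitrary: M)
  case (Cons x xs)
  obtain a i where x: "x = (a, i)"
    by force
  have ai: "count M a < i" "i \<le> f a"
    using Cons.prems(2) x by (auto simp: set_eq_iff)
  then have "(a, Suc (count M a)) \<in> set (x # xs)"
    unfolding Cons.prems(2) by auto
  then have i: "i = Suc (count M a)"
    using Cons.prems(3)[of a i "Suc (count M a)"] ai x by auto
  have "set xs = set (x # xs) - {x}"
    using Cons.prems(1) by auto
  also have "\<dots> = {(b, j). count (add_mset a M) b < j \<and> j \<le> f b}"
    unfolding Cons.prems(2) unfolding x i by (auto split: if_splits)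
  finally have set_xs: "set xs = {(b, j). count (add_mset a M) b < j \<and> j \<le> f b}" .
  have "labels_from (add_mset a M) (map fst xs) = xs"
  proof (rule Cons.IH[OF _ set_xs])
    show "distinct xs"
      using Cons.prems(1) by simp
    show "k < l" if "precedes xs (b, k) (b, l)" for b k l
      using Cons.prems(3)[of b k l] that by simp
  qed
  then show ?case
    using x i by simp
qed simp_all

text \<open>This turns a linear order on the labels back into a word: the only obstruction is the
  order among labels of the same letter.\<close>

lemma labels_map_fst:
  assumes "distinct xs" "set xs = label_set W"
    and "\<And>a i j. precedes xs (a, i) (a, j) \<Longrightarrow> i < j"
  shows "labels (map fst xs) = xs" "mset (map fst xs) = W"
proof -
  show "labels (map fst xs) = xs"
    using assms by (intro labels_from_map_fst[where f = "count W"]) (auto simp: label_set_def)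
  obtain w where w: "mset w = W"
    using ex_mset by blast
  have "mset xs = mset (labels w)"
    using assms(1,2) w by (simp add: set_eq_iff_mset_eq_distinct[symmetric] distinct_labels_from set_labels)
  then show "mset (map fst xs) = W"
    using w by (metis mset_map map_fst_labels_from)
qed

lemma finite_label_set: "finite (label_set W)"
  by (metis ex_mset set_labels List.finite_set)

section \<open>Co-inversions as the order of the labels\<close>

lemma coinv_iff_precedes: "(x, y) \<in> coinv w \<longleftrightarrow> fst x < fst y \<and> precedes (labels w) y x"
proof -
  have "occ_at w a i p \<longleftrightarrow> p < length w \<and> labels w ! p = (a, i)" for a i p
    by (auto simp: occ_at_def labels_from_nth)
  then show ?thesis
    by (cases x; cases y) (auto simp: coinv_def precedes_iff_nth; force)
qed

lemma precedes_labels_iff_not_coinv: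
  assumes "x \<in> label_set (mset w)" "y \<in> label_set (mset w)" "fst x < fst y"
  shows "precedes (labels w) x y \<longleftrightarrow> (x, y) \<notin> coinv w"
proof -
  have "x \<noteq> y"
    using assms(3) by auto
  then show ?thesis
    using assms precedes_total precedes_asym[OF distinct_labels_from]
    by (metis coinv_iff_precedes set_labels)
qed

lemma precedes_labels_same_iff:
  assumes "(a, i) \<in> label_set (mset w)" "(a, j) \<in> label_set (mset w)"
  shows "precedes (labels w) (a, i) (a, j) \<longleftrightarrow> i < j"
  using assms precedes_total[of "(a, i)" "labels w" "(a, j)"]
  by (metis Pair_inject less_asym' precedes_labels_from_same set_labels)

text \<open>The relative order of any two labels is known: for different letters the co-inversions
  decide, for equal letters the indices do.\<close>

lemma coinv_antisym:
  assumes "mset v = mset w" "coinv v = coinv w"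
  shows "v = w"
proof -
  have "labels v = labels w"
  proof (rule precedes_determines_list)
    fix x y assume *: "precedes (labels v) x y"
    then have xy: "x \<in> label_set (mset w)" "y \<in> label_set (mset w)"
      using precedes_in_set assms(1) by (metis set_labels)+
    obtain a i b j where eq: "x = (a, i)" "y = (b, j)"
      by force
    consider "a < b" | "b < a" | "a = b"
      by linarith
    then show "precedes (labels w) x y"
    proof cases
      case 1
      then show ?thesis
        using * xy assms eq by (simp add: precedes_labels_iff_not_coinv)
    next
      case 2
      then show ?thesis
        using * assms(2) eq by (metis coinv_iff_precedes fst_conv)
    next
      case 3
      then show ?thesis
        using * xy assms(1) eq by (simp add: precedes_labels_same_iff)
    qed
  qed (use assms(1) in \<open>auto simp: distinct_labels_from set_labels\<close>)
  then show ?thesis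
    by (metis map_fst_labels_from)
qed

section \<open>Words avoiding the pattern \<open>a \<cdots> b \<cdots> a\<close> with \<open>a < b\<close>\<close>

text \<open>The pattern is expressed by labels rather than by a factorization of the word, so that
  it can be compared directly with co-inversions.\<close>

definition avoiding :: "nat list \<Rightarrow> bool" where
  "avoiding w \<longleftrightarrow>
     (\<forall>a i b j k. a < b \<longrightarrow> precedes (labels w) (a, i) (b, j) \<longrightarrow> \<not> precedes (labels w) (b, j) (a, k))"

text \<open>A larger letter that stands before one occurrence of \<open>a\<close> stands before all
  of them: an earlier \<open>a\<close> would complete the forbidden pattern. This is the form in
  which avoidance is used for rewriting steps.\<close>

lemma avoidingD:
  assumes "avoiding w" "a < b" "precedes (labels w) (b, j) (a, k)" "(a, i) \<in> label_set (mset w)"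
  shows "precedes (labels w) (b, j) (a, i)"
proof -
  have "(b, j) \<in> set (labels w)" "(a, i) \<in> set (labels w)" "(b, j) \<noteq> (a, i)"
    using assms(2,4) precedes_in_set(1)[OF assms(3)] by (auto simp: set_labels)
  moreover have "\<not> precedes (labels w) (a, i) (b, j)"
    using assms(1-3) unfolding avoiding_def by blast
  ultimately show ?thesis
    using precedes_total by metis
qed

lemma precedes_labels_decomp:
  assumes "precedes (labels w) (a, i) (b, j)" "precedes (labels w) (b, j) (c, k)"
  shows "\<exists>u v x y. w = u @ [a] @ v @ [b] @ x @ [c] @ y"
proof -
  obtain p q q' r where pq: "p < q" "q < length w" "labels w ! p = (a, i)" "labels w ! q = (b, j)"
    and qr: "q' < r" "r < length w" "labels w ! q' = (b, j)" "labels w ! r = (c, k)"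
    using assms by (auto simp: precedes_iff_nth)
  have "q' = q"
    using pq(2,4) qr(1-3) distinct_labels_from[of "{#}" w] by (simp add: nth_eq_iff_index_eq[symmetric])
  then have "w ! p = a" "w ! q = b" "w ! r = c"
    using pq qr by (auto simp: labels_from_nth)
  obtain u d where 1: "w = u @ a # d" "d = drop (Suc p) w"
    using id_take_nth_drop[of p w] pq \<open>w ! p = a\<close> by auto
  have "d = take (q - Suc p) d @ b # drop (Suc q) w"
    using id_take_nth_drop[of "q - Suc p" d] 1(2) pq \<open>w ! q = b\<close> by simp
  then obtain v e where 2: "d = v @ b # e" "e = drop (Suc q) w"
    by blast
  have "e = take (r - Suc q) e @ c # drop (Suc r) w"
    using id_take_nth_drop[of "r - Suc q" e] 2(2) qr \<open>q' = q\<close> \<open>w ! r = c\<close> by simp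
  then obtain x y where 3: "e = x @ c # y"
    by blast
  have "w = u @ [a] @ v @ [b] @ x @ [c] @ y"
    using 1(1) 2(1) 3 by simp
  then show ?thesis
    by blast
qed

section \<open>Rewriting steps\<close>

text \<open>As the two letters differ, swapping them changes no occurrence number, and only the
  relative order of these two labels changes.\<close>

lemma coinv_swap:
  assumes "a < c"
  shows "coinv (u @ [c, a] @ v) =
    insert ((a, Suc (count (mset u) a)), (c, Suc (count (mset u) c))) (coinv (u @ [a, c] @ v))"
proof -
  define x where "x = (a, Suc (count (mset u) a))"
  define y where "y = (c, Suc (count (mset u) c))"
  define V where "V = labels_from (mset u + {#a, c#}) v"
  have "labels (u @ [a, c] @ v) = labels u @ [x, y] @ V" "labels (u @ [c, a] @ v) = labels u @ [y, x] @ V"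
    using assms by (simp_all add: labels_from_append x_def y_def V_def add_mset_commute)
  then have "(p, q) \<in> coinv (u @ [c, a] @ v) \<longleftrightarrow> (p, q) = (x, y) \<or> (p, q) \<in> coinv (u @ [a, c] @ v)" for p q
    unfolding coinv_iff_precedes using assms by (auto simp: precedes_append x_def y_def)
  then show ?thesis
    by (auto simp: x_def y_def)
qed

lemma metasylvester_step_mset: "metasylvester_step v w \<Longrightarrow> mset v = mset w"
  by (induction rule: metasylvester_step.induct) auto

lemma metasylvester_step_neq: "metasylvester_step v w \<Longrightarrow> v \<noteq> w"
  by (induction rule: metasylvester_step.induct) auto

lemma metasylvester_step_coinv: "metasylvester_step v w \<Longrightarrow> coinv v \<subseteq> coinv w"
proof (induction rule: metasylvester_step.induct)
  case (1 a c u v w)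
  then show ?case
    using coinv_swap[of a c u "v @ [a] @ w"] by auto
next
  case (2 a b c u v w x)
  then show ?case
    using coinv_swap[of a c "u @ [b] @ v" "w @ [b] @ x"] by auto
qed

text \<open>Between two occurrences of \<open>a\<close> enclosing a larger letter, some adjacent
  pair can be swapped: the first letter \<open>c > a\<close> and its left neighbour
  \<open>d\<close>, which is at most \<open>a\<close>. If \<open>d = a\<close>, the later
  \<open>a\<close> licenses the first rule; if \<open>d < a\<close>, the two enclosing occurrences
  of \<open>a\<close> license the second.\<close>

lemma metasylvester_step_exists:
  assumes "\<not> avoiding w"
  shows "\<exists>w'. metasylvester_step w w'"
proof -
  obtain a b i j k where "a < b" "precedes (labels w) (a, i) (b, j)" "precedes (labels w) (b, j) (a, k)"
    using assms by (auto simp: avoiding_def)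
  then obtain u v x y where w: "w = u @ [a] @ v @ [b] @ x @ [a] @ y"
    using precedes_labels_decomp by metis
  \<comment> \<open>Searching in \<open>v @ [b]\<close> guarantees that a letter above
    \<open>a\<close> is found before the closing \<open>a\<close>; possibly it is \<open>b\<close>
    itself.\<close>
  obtain v1 c v2 where v: "v @ [b] = v1 @ c # v2" "a < c" "\<forall>d\<in>set v1. \<not> a < d"
    using split_list_first_prop[of "v @ [b]" "\<lambda>d. a < d"] \<open>a < b\<close> by auto
  have w': "w = u @ [a] @ v1 @ [c] @ (v2 @ x) @ [a] @ y"
    using w arg_cong[OF v(1), of "\<lambda>l. u @ [a] @ l @ x @ [a] @ y"] by simp
  show ?thesis
  proof (cases v1 rule: rev_cases)
    case Nil
    then show ?thesis
      using w' v(2) metasylvester_step.intros(1)[of a c u "v2 @ x" y] by auto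
  next
    case (snoc v0 d)
    then consider "d = a" | "d < a"
      using v(3) by force
    then show ?thesis
    proof cases
      case 1
      then show ?thesis
        using w' v(2) snoc metasylvester_step.intros(1)[of a c "u @ [a] @ v0" "v2 @ x" y] by auto
    next
      case 2
      then show ?thesis
        using w' v(2) snoc metasylvester_step.intros(2)[of d a c u v0 "v2 @ x" y] by auto
    qed
  qed
qed

text \<open>A step adds a single co-inversion, so it suffices that \<open>t\<close> already has it.
  The letters that license the step yield co-inversions of \<open>v\<close>, hence of
  \<open>t\<close>, and avoidance in \<open>t\<close> transfers them to the swapped pair.\<close>

lemma metasylvester_step_below_avoiding:
  assumes "metasylvester_step v w" "avoiding t" "mset v = mset t"
  shows "coinv v \<subseteq> coinv t \<longleftrightarrow> coinv w \<subseteq> coinv t"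
proof
  assume "coinv w \<subseteq> coinv t"
  then show "coinv v \<subseteq> coinv t"
    using metasylvester_step_coinv[OF assms(1)] by blast
next
  assume le: "coinv v \<subseteq> coinv t"
  have prec: "precedes (labels t) y x" if "fst x < fst y" "precedes (labels v) y x" for x y
    using that le by (metis coinv_iff_precedes subset_iff)
  from assms(1) show "coinv w \<subseteq> coinv t"
  proof cases
    case (1 a c u v' w')
    define x where "x = (a, Suc (count (mset u) a))"
    define y where "y = (c, Suc (count (mset u) c))"
    \<comment> \<open>The later \<open>a\<close> that licenses the swap of \<open>x\<close> and
      \<open>y\<close>; \<open>t\<close> inherits from \<open>v\<close> that \<open>y\<close>
      precedes it, and by avoidance \<open>y\<close> precedes \<open>x\<close> as well.\<close>
    define x' where "x' = (a, Suc (count (mset u + {#a, c#} + mset v') a))"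
    have "labels v = labels u @ [x, y] @ labels_from (mset u + {#a, c#}) v' @ [x'] @
        labels_from (mset u + {#a, c, a#} + mset v') w'"
      using 1 by (simp add: labels_from_append x_def y_def x'_def add_mset_commute)
    then have "precedes (labels v) y x'" "x \<in> set (labels v)"
      by (simp_all add: precedes_append)
    then have "precedes (labels t) y x'" "x \<in> label_set (mset t)"
      using prec[of x' y] 1(3) assms(3) by (simp_all add: x'_def y_def set_labels)
    then have "precedes (labels t) y x"
      using avoidingD[OF assms(2) 1(3)] by (simp add: x_def y_def x'_def)
    then have "(x, y) \<in> coinv t"
      using 1(3) by (simp add: coinv_iff_precedes x_def y_def)
    then show ?thesis
      using 1 le coinv_swap[of a c u "v' @ [a] @ w'"] by (simp add: x_def y_def)
  next
    case (2 a b c u v' w' z)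
    define M where "M = mset (u @ [b] @ v')"
    define x where "x = (a, Suc (count M a))"
    define y where "y = (c, Suc (count M c))"
    define b1 where "b1 = (b, Suc (count (mset u) b))"
    define b2 where "b2 = (b, Suc (count (M + {#a, c#} + mset w') b))"
    have "labels v = labels u @ [b1] @ labels_from (mset u + {#b#}) v' @ [x, y] @
        labels_from (M + {#a, c#}) w' @ [b2] @ labels_from (M + {#a, c, b#} + mset w') z"
      using 2 by (simp add: labels_from_append x_def y_def b1_def b2_def M_def add_mset_commute)
    then have "precedes (labels v) b1 x" "precedes (labels v) y b2" "b1 \<in> set (labels v)"
      by (simp_all add: precedes_append)
    then have *: "precedes (labels t) b1 x" "precedes (labels t) y b2" "b1 \<in> label_set (mset t)"
      using prec[of x b1] prec[of b2 y] 2(3,4) assms(3)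
      by (simp_all add: x_def y_def b1_def b2_def set_labels)
    \<comment> \<open>Avoidance moves \<open>y\<close> from before the closing \<open>b2\<close> to
      before the opening \<open>b1\<close>. Since \<open>b1\<close> still precedes the smaller
      letter \<open>x\<close> in \<open>t\<close>, the new co-inversion follows by
      transitivity.\<close>
    then have "precedes (labels t) y b1"
      using avoidingD[OF assms(2) 2(4)] by (simp add: b1_def b2_def y_def)
    then have "precedes (labels t) y x"
      using precedes_trans[OF distinct_labels_from _ *(1)] by simp
    then have "(x, y) \<in> coinv t"
      using 2(3,4) by (simp add: coinv_iff_precedes x_def y_def)
    then show ?thesis
      using 2 le coinv_swap[of a c "u @ [b] @ v'" "w' @ [b] @ z"] by (simp add: x_def y_def M_def)
  qed
qed

text \<open>The equivalence, rather than one implication, lets the induction follow steps in both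
  directions.\<close>

lemma equivclp_below_avoiding:
  assumes "equivclp metasylvester_step v w" "avoiding t" "mset v = mset t"
  shows "coinv v \<subseteq> coinv t \<longleftrightarrow> coinv w \<subseteq> coinv t"
  using assms(1)
proof (induction rule: equivclp_induct)
  case (step y z)
  have "mset y = mset t" "mset z = mset t"
    using step metasylvester_mset[OF step(1)] metasylvester_step_mset assms(3) by metis+
  then show ?case
    using step metasylvester_step_below_avoiding[OF _ assms(2)] by blast
qed simp

section \<open>Maximal elements of the classes\<close>

lemma metasylvester_max_iff:
  "w \<in> metasylvester_max m n \<longleftrightarrow> w \<in> mperms m n \<and> avoiding w"
proof -
  have equiv: "equiv (mperms m n) (metasylvester_cong m n)"
    by (intro equivI refl_onI symI transI)
       (auto simp: metasylvester_cong_def intro: equivclp_sym equivclp_trans)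
  have cls: "C \<in> metasylvester_classes m n \<and> w \<in> C \<longleftrightarrow>
      w \<in> mperms m n \<and> C = metasylvester_cong m n `` {w}" for C
  proof
    assume C: "C \<in> metasylvester_classes m n \<and> w \<in> C"
    then obtain v where v: "C = metasylvester_cong m n `` {v}" "(v, w) \<in> metasylvester_cong m n"
      by (auto simp: metasylvester_classes_def elim: quotientE)
    then show "w \<in> mperms m n \<and> C = metasylvester_cong m n `` {w}"
      using equiv_class_eq[OF equiv v(2)] by (simp add: metasylvester_cong_def)
  next
    assume "w \<in> mperms m n \<and> C = metasylvester_cong m n `` {w}"
    then show "C \<in> metasylvester_classes m n \<and> w \<in> C"
      using equiv_class_self[OF equiv] by (simp add: metasylvester_classes_def quotientI)
  qed
  have "w \<in> metasylvester_max m n \<longleftrightarrow> (\<exists>C. (C \<in> metasylvester_classes m n \<and> w \<in> C) \<and>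
      (\<forall>v \<in> C. coinv w \<subseteq> coinv v \<longrightarrow> v = w))"
    by (simp add: metasylvester_max_def mperm_lattice_def Bex_def conj_assoc)
  also have "\<dots> \<longleftrightarrow> w \<in> mperms m n \<and>
      (\<forall>v \<in> metasylvester_cong m n `` {w}. coinv w \<subseteq> coinv v \<longrightarrow> v = w)"
    unfolding cls by blast
  also have "\<dots> \<longleftrightarrow> w \<in> mperms m n \<and>
      (\<forall>v \<in> mperms m n. equivclp metasylvester_step w v \<longrightarrow> coinv w \<subseteq> coinv v \<longrightarrow> v = w)"
    by (auto simp: metasylvester_cong_def)
  finally have max: "w \<in> metasylvester_max m n \<longleftrightarrow> w \<in> mperms m n \<and>
      (\<forall>v \<in> mperms m n. equivclp metasylvester_step w v \<longrightarrow> coinv w \<subseteq> coinv v \<longrightarrow> v = w)" .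
  show ?thesis
  proof (intro iffI conjI; (elim conjE)?)
    assume w: "w \<in> metasylvester_max m n"
    then show "w \<in> mperms m n"
      using max by blast
    show "avoiding w"
    proof (rule ccontr)
      assume "\<not> avoiding w"
      then obtain v where v: "metasylvester_step w v"
        using metasylvester_step_exists by blast
      then have "v \<in> mperms m n"
        using \<open>w \<in> mperms m n\<close> metasylvester_step_mset by (auto simp: mperms_def)
      then show False
        using v w max metasylvester_step_coinv metasylvester_step_neq by blast
    qed
  next
    assume w: "w \<in> mperms m n" "avoiding w"
    have "v = w" if "v \<in> mperms m n" "equivclp metasylvester_step w v" "coinv w \<subseteq> coinv v" for v
    proof (rule coinv_antisym)
      show "mset v = mset w"
        using metasylvester_mset[OF that(2)] by simp
      \<comment> \<open>With \<open>t = w\<close>, reflexivity at \<open>w\<close> is transported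
        along the class and gives \<open>coinv v \<subseteq> coinv w\<close>.\<close>
      show "coinv v = coinv w"
        using that equivclp_below_avoiding[OF that(2) w(2)] by simp
    qed
    then show "w \<in> metasylvester_max m n"
      using w max by blast
  qed
qed

section \<open>Meets\<close>

text \<open>The non-coinversions of the meet form the transitive closure of the union of the
  non-coinversions; with \<open>S = {}\<close> this yields the top element.\<close>

lemma coinv_Inf_exists:
  assumes S: "\<And>s. s \<in> S \<Longrightarrow> mset s = W"
  shows "\<exists>w. mset w = W \<and> (\<forall>s\<in>S. coinv w \<subseteq> coinv s) \<and>
    (\<forall>t. mset t = W \<longrightarrow> (\<forall>s\<in>S. coinv t \<subseteq> coinv s) \<longrightarrow> coinv t \<subseteq> coinv w) \<and>
    ((\<forall>s\<in>S. avoiding s) \<longrightarrow> avoiding w)"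
proof -
  define L where "L = label_set W"
  \<comment> \<open>The order of the labels in the weakly increasing word; co-inversions measure the
    deviation from it.\<close>
  define lx :: "nat \<times> nat \<Rightarrow> nat \<times> nat \<Rightarrow> bool"
    where "lx x y \<longleftrightarrow> fst x < fst y \<or> fst x = fst y \<and> snd x < snd y" for x y
  \<comment> \<open>Pairs that the meet must keep in increasing order: some member of
    \<open>S\<close> does so, or the letters agree. The latter pairs are present even when
    \<open>S\<close> is empty.\<close>
  define R where "R = {(x, y). x \<in> L \<and> y \<in> L \<and> lx x y \<and>
    (fst x = fst y \<or> (\<exists>s\<in>S. precedes (labels s) x y))}"
  \<comment> \<open>The relation that keeps exactly the pairs of \<open>R\<^sup>+\<close> in
    increasing order and reverses all others. It has to be shown to be a linear order on
    \<open>L\<close>.\<close>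
  define less where "less x y \<longleftrightarrow> (x, y) \<in> R\<^sup>+ \<or> lx y x \<and> (y, x) \<notin> R\<^sup>+" for x y
  have lx_trans: "lx x z" if "lx x y" "lx y z" for x y z
    using that by (auto simp: lx_def)
  have lx_total: "lx x y \<or> lx y x" if "x \<noteq> y" for x y
    using that by (cases x; cases y) (auto simp: lx_def)
  have lx_asym: "\<not> lx y x" if "lx x y" for x y
    using that by (auto simp: lx_def)
  have T_lx: "lx x y" if "(x, y) \<in> R\<^sup>+" for x y
    using that by (induction rule: trancl_induct) (auto simp: R_def intro: lx_trans)
  \<comment> \<open>In a word with \<open>x\<close> before \<open>z\<close>, no \<open>y\<close> can
    be both before \<open>x\<close> and after \<open>z\<close>. This dual of transitivity is what
    keeps the reversed pairs transitive.\<close>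
  have R_split: "(x, y) \<in> R \<or> (y, z) \<in> R" if xz: "(x, z) \<in> R" "y \<in> L" "lx x y" "lx y z" for x y z
  proof (cases "fst x = fst z")
    case True
    then have "fst x = fst y"
      using xz by (auto simp: lx_def)
    then show ?thesis
      using xz by (auto simp: R_def)
  next
    case False
    then obtain s where s: "s \<in> S" "precedes (labels s) x z"
      using xz(1) by (auto simp: R_def)
    have "x \<in> set (labels s)" "y \<in> set (labels s)"
      using xz S[OF s(1)] by (auto simp: R_def L_def set_labels)
    moreover have "x \<noteq> y"
      using xz(3) lx_asym by blast
    ultimately have "precedes (labels s) x y \<or> precedes (labels s) y z"
      using s(2) precedes_total precedes_trans[OF distinct_labels_from] by metis
    then show ?thesis
      using xz s(1) by (auto simp: R_def)
  qed
  \<comment> \<open>The splitting property survives transitive closure: \<open>y\<close> is compared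
    with the source \<open>u\<close> of the last arrow, and either the part before \<open>u\<close>
    or the last arrow is split.\<close>
  have T_split: "(x, y) \<in> R\<^sup>+ \<or> (y, z) \<in> R\<^sup>+" if "(x, z) \<in> R\<^sup>+" "y \<in> L" "lx x y" "lx y z" for x y z
    using that
  proof (induction rule: trancl_induct)
    case (base z)
    then show ?case
      using R_split by blast
  next
    case (step u z)
    consider "y = u" | "lx y u" | "lx u y"
      using lx_total by blast
    then show ?case
    proof cases
      case 1
      then show ?thesis
        using step by blast
    next
      case 2
      then show ?thesis
        using step by (meson trancl.trancl_into_trancl)
    next
      case 3
      then show ?thesis
        using step R_split by (meson r_into_trancl' trancl.trancl_into_trancl)
    qed
  qed
  have less_irrefl: "\<not> less x x" for x
    using T_lx lx_asym unfolding less_def by blast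
  have less_total: "less x y \<or> less y x" if "x \<noteq> y" for x y
    using that lx_total unfolding less_def by blast
  \<comment> \<open>Two kept pairs compose by transitivity of \<open>R\<^sup>+\<close>, two reversed
    pairs by \<open>T_split\<close>. In the mixed cases, the position of \<open>x\<close> and
    \<open>z\<close> under \<open>lx\<close> decides which of the two properties applies.\<close>
  have less_trans: "less x z" if L: "x \<in> L" "y \<in> L" "z \<in> L" and xy: "less x y" and yz: "less y z" for x y z
  proof -
    consider (TT) "(x, y) \<in> R\<^sup>+" "(y, z) \<in> R\<^sup>+"
      | (TN) "(x, y) \<in> R\<^sup>+" "lx z y" "(z, y) \<notin> R\<^sup>+"
      | (NT) "lx y x" "(y, x) \<notin> R\<^sup>+" "(y, z) \<in> R\<^sup>+"
      | (NN) "lx y x" "(y, x) \<notin> R\<^sup>+" "lx z y" "(z, y) \<notin> R\<^sup>+"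
      using xy yz unfolding less_def by blast
    then show ?thesis
    proof cases
      case TT
      then show ?thesis
        unfolding less_def by (meson trancl_trans)
    next
      case TN
      consider "x = z" | "lx x z" | "lx z x"
        using lx_total by blast
      then show ?thesis
      proof cases
        case 2
        then show ?thesis
          using TN T_split[OF TN(1) L(3)] unfolding less_def by blast
      qed (use TN in \<open>auto simp: less_def intro: trancl_trans\<close>)
    next
      case NT
      consider "x = z" | "lx x z" | "lx z x"
        using lx_total by blast
      then show ?thesis
      proof cases
        case 2
        then show ?thesis
          using NT T_split[OF NT(3) L(1)] unfolding less_def by blast
      qed (use NT in \<open>auto simp: less_def intro: trancl_trans\<close>)
    next
      case NN
      then show ?thesis
        using T_split[OF _ L(2)] lx_trans unfolding less_def by blast
    qed
  qed
  have "\<exists>xs. distinct xs \<and> set xs = L \<and> sorted_wrt less xs"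
  proof (rule sorted_list_exists)
    show "finite L"
      by (simp add: L_def finite_label_set)
    show "less x y \<or> less y x" if "x \<noteq> y" for x y
      using that by (rule less_total)
    show "less x z" if "x \<in> L" "y \<in> L" "z \<in> L" "less x y" "less y z" for x y z
      using that by (rule less_trans)
    show "\<not> less x x" for x
      by (rule less_irrefl)
  qed
  then obtain xs where xs: "distinct xs" "set xs = L" "sorted_wrt less xs"
    by blast
  have xs_less: "less x y" if "precedes xs x y" for x y
    using that xs(3) unfolding sorted_wrt_iff_precedes by blast
  have less_xs: "precedes xs x y" if "less x y" "x \<in> L" "y \<in> L" for x y
  proof -
    have "x \<noteq> y" "\<not> less y x"
      using that less_irrefl less_trans by blast+
    then show ?thesis
      using that(2,3) xs(2) xs_less precedes_total by metis
  qed
  \<comment> \<open>All increasing pairs of equal letters lie in \<open>R\<close>, so none of them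
    is reversed and the linear order is that of a word.\<close>
  have less_same: "i < j" if "less (a, i) (a, j)" "(a, i) \<in> L" "(a, j) \<in> L" for a i j
  proof -
    have "((a, j), (a, i)) \<in> R" if "j < i"
      using that \<open>(a, i) \<in> L\<close> \<open>(a, j) \<in> L\<close> by (simp add: R_def lx_def)
    then have "\<not> j < i"
      using that(1) T_lx[of "(a, i)" "(a, j)"] by (auto simp: less_def lx_def)
    moreover have "i \<noteq> j"
      using that(1) less_irrefl by blast
    ultimately show ?thesis
      by simp
  qed
  have same: "i < j" if "precedes xs (a, i) (a, j)" for a i j
    using less_same[OF xs_less[OF that]] precedes_in_set[OF that] xs(2) by simp
  define w where "w = map fst xs"
  have labels_w: "labels w = xs" and mset_w: "mset w = W"
    using labels_map_fst[OF xs(1) xs(2)[unfolded L_def] same] by (simp_all add: w_def)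
  have coinv_w: "(x, y) \<in> coinv w \<longleftrightarrow> x \<in> L \<and> y \<in> L \<and> fst x < fst y \<and> (x, y) \<notin> R\<^sup>+" for x y
  proof -
    have "less y x \<longleftrightarrow> (x, y) \<notin> R\<^sup>+" if "fst x < fst y"
      using that T_lx[of y x] unfolding less_def by (auto simp: lx_def)
    then show ?thesis
      using xs_less[of y x] less_xs[of y x] precedes_in_set[of xs y x] xs(2)
      unfolding coinv_iff_precedes labels_w by blast
  qed
  have lower: "coinv w \<subseteq> coinv s" if "s \<in> S" for s
  proof (rule subrelI)
    fix x y assume "(x, y) \<in> coinv w"
    then have *: "x \<in> L" "y \<in> L" "fst x < fst y" "(x, y) \<notin> R"
      unfolding coinv_w by blast+
    then have "\<not> precedes (labels s) x y"
      using that by (auto simp: R_def lx_def)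
    then show "(x, y) \<in> coinv s"
      using * S[OF that] precedes_labels_iff_not_coinv L_def by blast
  qed
  have greatest: "coinv t \<subseteq> coinv w" if t: "mset t = W" "\<forall>s\<in>S. coinv t \<subseteq> coinv s" for t
  proof -
    have R_t: "precedes (labels t) x y" if xy: "(x, y) \<in> R" for x y
    proof (cases "fst x = fst y")
      case True
      then show ?thesis
        using xy t(1) precedes_labels_same_iff[of "fst x" "snd x" t "snd y"]
        by (cases x; cases y) (auto simp: R_def lx_def L_def)
    next
      case False
      then obtain s where s: "s \<in> S" "precedes (labels s) x y" "fst x < fst y"
        using xy by (auto simp: R_def lx_def)
      then have "(x, y) \<notin> coinv t"
        using xy S t precedes_labels_iff_not_coinv[of x s y] by (auto simp: R_def L_def)
      then show ?thesis
        using xy t(1) s(3) precedes_labels_iff_not_coinv[of x t y] by (auto simp: R_def L_def)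
    qed
    \<comment> \<open>A common lower bound keeps every pair of \<open>R\<close> in order, and the
      order of its labels is transitive, so it keeps \<open>R\<^sup>+\<close> too.\<close>
    have T_t: "precedes (labels t) x y" if "(x, y) \<in> R\<^sup>+" for x y
      using that by (induction rule: trancl_induct) (auto intro: R_t precedes_trans[OF distinct_labels_from])
    show ?thesis
    proof (rule subrelI)
      fix x y assume "(x, y) \<in> coinv t"
      then have "fst x < fst y" and yx: "precedes (labels t) y x"
        by (auto simp: coinv_iff_precedes)
      moreover have "x \<in> L" "y \<in> L"
        using precedes_in_set[OF yx] t(1) by (simp_all add: set_labels L_def)
      moreover have "(x, y) \<notin> R\<^sup>+"
        using T_t yx precedes_asym[OF distinct_labels_from] by blast
      ultimately show "(x, y) \<in> coinv w"
        unfolding coinv_w by blast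
    qed
  qed
  have "avoiding w" if av: "\<forall>s\<in>S. avoiding s"
  proof -
    have R_move: "((a, k), y) \<in> R" if aiy: "((a, i), y) \<in> R" "a < fst y" "(a, k) \<in> L" for a i k y
    proof -
      obtain s where s: "s \<in> S" "precedes (labels s) (a, i) y"
        using aiy by (auto simp: R_def)
      then have "\<not> precedes (labels s) y (a, k)"
        using av aiy(2) unfolding avoiding_def by (metis prod.collapse)
      moreover have "(a, k) \<in> set (labels s)" "y \<in> set (labels s)" "(a, k) \<noteq> y"
        using aiy S[OF s(1)] by (auto simp: R_def L_def set_labels)
      ultimately have "precedes (labels s) (a, k) y"
        using precedes_total by metis
      then show ?thesis
        using aiy s(1) by (auto simp: R_def lx_def)
    qed
    \<comment> \<open>Induction from the start of the chain: arrows within the letter of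
      \<open>x\<close> are skipped, and the first arrow leaving that letter is restarted at index
      \<open>k\<close> by \<open>R_move\<close>.\<close>
    have T_move: "((fst x, k), y) \<in> R\<^sup>+" if "(x, y) \<in> R\<^sup>+" "fst x < fst y" "(fst x, k) \<in> L" for x k y
      using that
    proof (induction rule: converse_trancl_induct)
      case (base x)
      then show ?case
        using R_move[of "fst x" "snd x" y k] by auto
    next
      case (step x u)
      show ?case
      proof (cases "fst x = fst u")
        case True
        then show ?thesis
          using step by metis
      next
        case False
        then have "fst x < fst u"
          using step(1) by (auto simp: R_def lx_def)
        then have "((fst x, k), u) \<in> R"
          using R_move[of "fst x" "snd x" u k] step by auto
        then show ?thesis
          using step(2) by (rule trancl_into_trancl2)
      qed
    qed
    show ?thesis
      unfolding avoiding_def labels_w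
    proof (intro allI impI notI)
      fix a i b j k
      assume "a < b" and 1: "precedes xs (a, i) (b, j)" and 2: "precedes xs (b, j) (a, k)"
      \<comment> \<open>As \<open>a < b\<close>, the pair is not reversed, so it is joined by a
        chain. Restarting the chain at the later \<open>a\<close> contradicts that this
        \<open>a\<close> comes after \<open>b\<close>.\<close>
      have "((a, i), (b, j)) \<in> R\<^sup>+"
        using xs_less[OF 1] \<open>a < b\<close> by (auto simp: less_def lx_def)
      moreover have "(a, k) \<in> L"
        using precedes_in_set(2)[OF 2] xs(2) by simp
      ultimately have "((a, k), (b, j)) \<in> R\<^sup>+"
        using T_move[of "(a, i)" "(b, j)" k] \<open>a < b\<close> by simp
      then have "less (a, k) (b, j)"
        by (simp add: less_def)
      then show False
        using less_trans[of "(a, k)" "(b, j)" "(a, k)"] xs_less[OF 2] less_irrefl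
          precedes_in_set[OF 2] xs(2) by blast
    qed
  qed
  then show ?thesis
    using mset_w lower greatest by blast
qed

section \<open>The lattice of avoiding words\<close>

theorem theorem2p7:
  fixes m n :: nat
  assumes "m \<ge> 1" and "n \<ge> 1"
  shows "lattice (metasylvester_poset m n)"
proof -
  let ?P = "metasylvester_poset m n" and ?A = "metasylvester_max m n"
  have car: "carrier ?P = ?A" and eq: "x .=\<^bsub>?P\<^esub> y \<longleftrightarrow> x = y"
    and le: "x \<sqsubseteq>\<^bsub>?P\<^esub> y \<longleftrightarrow> coinv x \<subseteq> coinv y" for x y
    by (simp_all add: metasylvester_poset_def mperm_lattice_def)
  interpret partial_order ?P
  proof
    fix x y assume "x \<in> carrier ?P" "y \<in> carrier ?P" "x \<sqsubseteq>\<^bsub>?P\<^esub> y" "y \<sqsubseteq>\<^bsub>?P\<^esub> x"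
    then show "x .=\<^bsub>?P\<^esub> y"
      by (auto simp: car eq le metasylvester_max_iff mperms_def intro: coinv_antisym)
  qed (auto simp: eq le car fun_eq_iff)
  \<comment> \<open>The empty \<open>S\<close> is included, so \<open>Sup\<close> can take the meet
    of the upper bounds without showing that any exist.\<close>
  have Inf: "\<exists>i. greatest ?P i (Lower ?P S)" if "S \<subseteq> ?A" for S
  proof -
    define W where "W = mset (concat (map (replicate m) [1..<Suc n]))"
    have A: "w \<in> ?A \<longleftrightarrow> mset w = W \<and> avoiding w" for w
      by (simp add: metasylvester_max_iff mperms_def W_def)
    obtain w where w: "mset w = W" "\<forall>s\<in>S. coinv w \<subseteq> coinv s"
      "\<And>t. mset t = W \<Longrightarrow> \<forall>s\<in>S. coinv t \<subseteq> coinv s \<Longrightarrow> coinv t \<subseteq> coinv w"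
      "\<forall>s\<in>S. avoiding s \<Longrightarrow> avoiding w"
      using coinv_Inf_exists[of S W] A \<open>S \<subseteq> ?A\<close> by blast
    have "greatest ?P w (Lower ?P S)"
    proof (rule greatest_LowerI)
      show "w \<sqsubseteq>\<^bsub>?P\<^esub> s" if "s \<in> S" for s
        using w(2) that by (simp add: le)
      show "t \<sqsubseteq>\<^bsub>?P\<^esub> w" if "t \<in> Lower ?P S" for t
      proof -
        have "t \<in> ?A" "\<forall>s\<in>S. coinv t \<subseteq> coinv s"
          using that \<open>S \<subseteq> ?A\<close> by (auto simp: Lower_def car le)
        then show ?thesis
          using w(3)[of t] by (simp add: A le)
      qed
      show "S \<subseteq> carrier ?P"
        using \<open>S \<subseteq> ?A\<close> car by simp
      have "\<forall>s\<in>S. avoiding s"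
        using \<open>S \<subseteq> ?A\<close> A by blast
      then show "w \<in> carrier ?P"
        using w(1,4) by (simp add: A car)
    qed
    then show ?thesis ..
  qed
  have Sup: "\<exists>s. least ?P s (Upper ?P S)" if "S \<subseteq> ?A" for S
  proof -
    have "Upper ?P S \<subseteq> ?A"
      using Upper_closed[of ?P S] unfolding car .
    then obtain i where i: "greatest ?P i (Lower ?P (Upper ?P S))"
      using Inf by blast
    have "least ?P i (Upper ?P S)"
    proof (rule least_UpperI)
      show "s \<sqsubseteq>\<^bsub>?P\<^esub> i" if "s \<in> S" for s
      proof -
        have "s \<in> Lower ?P (Upper ?P S)"
          using that \<open>S \<subseteq> ?A\<close> by (auto simp: Upper_def Lower_def car)
        then show ?thesis
          using greatest_le[OF i] by simp
      qed
      show "i \<sqsubseteq>\<^bsub>?P\<^esub> u" if "u \<in> Upper ?P S" for u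
        using greatest_Lower_below[OF i that] by simp
      show "S \<subseteq> carrier ?P"
        using \<open>S \<subseteq> ?A\<close> car by simp
      show "i \<in> carrier ?P"
        using i by simp
    qed
    then show ?thesis ..
  qed
  show ?thesis
  proof unfold_locales
    fix x y assume "x \<in> carrier ?P" "y \<in> carrier ?P"
    then have "{x, y} \<subseteq> ?A"
      by (simp add: car)
    then show "\<exists>s. least ?P s (Upper ?P {x, y})" "\<exists>s. greatest ?P s (Lower ?P {x, y})"
      by (fact Sup Inf)+
  qed
qed

end
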